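(* Let $\nu\in\mathbb{C}$ with $|\nu|\le 1$, let $\Phi(z)=\nu z$, and let $\Upsilon$ be an entire function on $\mathbb{C}$ such that the weighted composition operator $C_{\Upsilon,\Phi}$ is bounded on $H_E(\zeta)$. Then $C_{\Upsilon,\Phi}$ is self-adjoint if and only if $$\Upsilon(z)=\overline{\Upsilon(0)}\quad\text{for all } z\in\mathbb{C}$$ and, according to the value of $\Upsilon(0)$, the corresponding one of the following is true: (i) if $\Upsilon(0)=0$, then $\Upsilon\equiv 0$, and consequently $C_{\Upsilon,\Phi}\equiv 0$; (ii) if $\Upsilon(0)\ne 0$, then $\nu$ is a real number.
   Context: Let $\mathbb{N}_0=\mathbb{N}\cup\{0\}$ and let $\zeta=(\zeta_n)_{n\in\mathbb{N}_0}$ be a sequence of positive real numbers with $\lim_{n\to\infty}\zeta_n^{1/n}=\infty$. The weighted Hardy space of entire functions induced by $\zeta$ is the Hilbert space $H_E(\zeta)=\{g(z)=\sum_{n=0}^\infty b_nz^n : \|g\|^2=\sum_{n=0}^\infty |b_n|^2\zeta_n^2<\infty\}$ of entire functions on $\mathbb{C}$, with inner product $\langle g,h\rangle=\sum_{n=0}^\infty b_n\overline{c_n}\zeta_n^2$ for $g(z)=\sum b_nz^n$ and $h(z)=\sum c_nz^n$ in $H_E(\zeta)$. For entire functions $\Upsilon,\Phi:\mathbb{C}\to\mathbb{C}$, the weighted composition operator is $C_{\Upsilon,\Phi}f=\Upsilon\cdot(f\circ\Phi)$; it is bounded on $H_E(\zeta)$ if it maps $H_E(\zeta)$ into itself as a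 bounded linear operator. *)

theory Defs
  imports "HOL-Complex_Analysis.Complex_Analysis"
begin

definition hardy_space_E :: "(nat \<Rightarrow> real) \<Rightarrow> (complex \<Rightarrow> complex) set" where
  "hardy_space_E \<zeta> =
     {g. \<exists>b. (\<forall>z. (\<lambda>n. b n * z ^ n) sums g z) \<and> summable (\<lambda>n. (cmod (b n))\<^sup>2 * (\<zeta> n)\<^sup>2)}"

definition taylor_coeff :: "(complex \<Rightarrow> complex) \<Rightarrow> nat \<Rightarrow> complex" where
  "taylor_coeff g n = fps_nth (fps_expansion g 0) n"

text \<open>The coefficient sequence witnessing membership in \<^const>\<open>hardy_space_E\<close> is unique, so
  the inner product and the norm can be read off from \<^const>\<open>taylor_coeff\<close>.\<close>

lemma taylor_coeff_eqI:
  assumes "\<And>z. (\<lambda>n. b n * z ^ n) sums g z"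
  shows "taylor_coeff g = b"
proof -
  have "g has_fps_expansion Abs_fps b"
    by (rule has_fps_expansionI) (simp add: assms)
  from fps_nth_fps_expansion[OF this] show ?thesis
    by (intro ext) (simp add: taylor_coeff_def fps_expansion_def)
qed

lemma taylor_coeff_sums:
  assumes "g holomorphic_on UNIV"
  shows "(\<lambda>n. taylor_coeff g n * z ^ n) sums g z"
proof -
  have "g holomorphic_on ball 0 (norm z + 1)"
    using assms by (rule holomorphic_on_subset) simp
  from holomorphic_power_series[OF this, of z] show ?thesis
    by (simp add: taylor_coeff_def fps_expansion_def)
qed

lemma hardy_space_E_iff:
  "g \<in> hardy_space_E \<zeta> \<longleftrightarrow>
     g holomorphic_on UNIV \<and> summable (\<lambda>n. (cmod (taylor_coeff g n))\<^sup>2 * (\<zeta> n)\<^sup>2)"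
proof
  assume "g \<in> hardy_space_E \<zeta>"
  then obtain b where b: "\<And>z. (\<lambda>n. b n * z ^ n) sums g z"
      and s: "summable (\<lambda>n. (cmod (b n))\<^sup>2 * (\<zeta> n)\<^sup>2)"
    by (auto simp: hardy_space_E_def)
  have "g holomorphic_on ball 0 r" for r
    by (rule power_series_holomorphic[of _ _ b]) (simp add: b)
  then have "g field_differentiable at z" for z
    by (metis centre_in_ball dist_0_norm holomorphic_on_imp_differentiable_at less_add_one
        mem_ball open_ball)
  then have "g holomorphic_on UNIV"
    by (simp add: holomorphic_on_def)
  with s taylor_coeff_eqI[OF b]
  show "g holomorphic_on UNIV \<and> summable (\<lambda>n. (cmod (taylor_coeff g n))\<^sup>2 * (\<zeta> n)\<^sup>2)"
    by simp
next
  assume "g holomorphic_on UNIV \<and> summable (\<lambda>n. (cmod (taylor_coeff g n))\<^sup>2 * (\<zeta> n)\<^sup>2)"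
  then show "g \<in> hardy_space_E \<zeta>"
    using taylor_coeff_sums by (auto simp: hardy_space_E_def)
qed

definition hardy_inner :: "(nat \<Rightarrow> real) \<Rightarrow> (complex \<Rightarrow> complex) \<Rightarrow> (complex \<Rightarrow> complex) \<Rightarrow> complex" where
  "hardy_inner \<zeta> g h =
     (\<Sum>n. taylor_coeff g n * cnj (taylor_coeff h n) * of_real ((\<zeta> n)\<^sup>2))"

definition hardy_norm :: "(nat \<Rightarrow> real) \<Rightarrow> (complex \<Rightarrow> complex) \<Rightarrow> real" where
  "hardy_norm \<zeta> g = sqrt (\<Sum>n. (cmod (taylor_coeff g n))\<^sup>2 * (\<zeta> n)\<^sup>2)"

definition weighted_comp_op ::
  "(complex \<Rightarrow> complex) \<Rightarrow> (complex \<Rightarrow> complex) \<Rightarrow> (complex \<Rightarrow> complex) \<Rightarrow> (complex \<Rightarrow> complex)" where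
  "weighted_comp_op \<Upsilon> \<Phi> f = (\<lambda>z. \<Upsilon> z * f (\<Phi> z))"

definition bounded_op_on ::
  "(nat \<Rightarrow> real) \<Rightarrow> ((complex \<Rightarrow> complex) \<Rightarrow> (complex \<Rightarrow> complex)) \<Rightarrow> bool" where
  "bounded_op_on \<zeta> T \<longleftrightarrow>
     (\<forall>f \<in> hardy_space_E \<zeta>. T f \<in> hardy_space_E \<zeta>) \<and>
     (\<forall>f \<in> hardy_space_E \<zeta>. \<forall>g \<in> hardy_space_E \<zeta>.
        T (\<lambda>z. f z + g z) = (\<lambda>z. T f z + T g z)) \<and>
     (\<forall>c. \<forall>f \<in> hardy_space_E \<zeta>. T (\<lambda>z. c * f z) = (\<lambda>z. c * T f z)) \<and>
     (\<exists>K. \<forall>f \<in> hardy_space_E \<zeta>. hardy_norm \<zeta> (T f) \<le> K * hardy_norm \<zeta> f)"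

definition is_adjoint_on ::
  "(nat \<Rightarrow> real) \<Rightarrow> ((complex \<Rightarrow> complex) \<Rightarrow> (complex \<Rightarrow> complex)) \<Rightarrow>
   ((complex \<Rightarrow> complex) \<Rightarrow> (complex \<Rightarrow> complex)) \<Rightarrow> bool" where
  "is_adjoint_on \<zeta> T S \<longleftrightarrow> bounded_op_on \<zeta> S \<and>
     (\<forall>f \<in> hardy_space_E \<zeta>. \<forall>g \<in> hardy_space_E \<zeta>.
        hardy_inner \<zeta> (T f) g = hardy_inner \<zeta> f (S g))"

definition self_adjoint_on ::
  "(nat \<Rightarrow> real) \<Rightarrow> ((complex \<Rightarrow> complex) \<Rightarrow> (complex \<Rightarrow> complex)) \<Rightarrow> bool" where
  "self_adjoint_on \<zeta> T \<longleftrightarrow> bounded_op_on \<zeta> T \<and> is_adjoint_on \<zeta> T T"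

end

theory Submission
  imports Defs
begin

text \<open>Test self-adjointness of \<open>T f = \<Upsilon> \<cdot> (f \<circ> \<Phi>)\<close> on monomials. Comparing
  \<open>\<langle>T 1, z\<^sup>m\<rangle>\<close> with \<open>\<langle>1, T z\<^sup>m\<rangle>\<close> kills every Taylor coefficient of \<open>\<Upsilon>\<close> of positive order and
  makes \<open>\<Upsilon>(0)\<close> real; comparing \<open>\<langle>T z, z\<rangle>\<close> with \<open>\<langle>z, T z\<rangle>\<close> makes \<open>\<Upsilon>(0)\<nu>\<close> real. Conversely, for
  constant \<open>\<Upsilon>\<close> the operator is diagonal on monomials with eigenvalues \<open>\<Upsilon>(0)\<nu>\<^sup>n\<close>, which are real.\<close>

lemma monom_sums:
  fixes z :: complex
  shows "(\<lambda>n. (if n = m then 1 else 0) * z ^ n) sums z ^ m"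
  using sums_single[of m "\<lambda>n. z ^ n"] by (simp add: if_distrib if_distribR cong: if_cong)

lemma taylor_coeff_monom: "taylor_coeff (\<lambda>z. z ^ m) = (\<lambda>n. if n = m then 1 else 0)"
  by (rule taylor_coeff_eqI) (rule monom_sums)

lemma monom_in_hardy_space_E: "(\<lambda>z. z ^ m) \<in> hardy_space_E \<zeta>"
proof -
  have "summable (\<lambda>n. (cmod (taylor_coeff (\<lambda>z. z ^ m) n))\<^sup>2 * (\<zeta> n)\<^sup>2)"
    by (rule summable_finite[of "{m}"]) (auto simp: taylor_coeff_monom)
  then show ?thesis
    by (auto simp: hardy_space_E_iff intro!: holomorphic_intros)
qed

lemma taylor_coeff_0: "taylor_coeff g 0 = g 0"
  by (simp add: taylor_coeff_def fps_expansion_def)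

text \<open>Monomials are orthogonal, so only the term of index \<open>m\<close> survives; this
  turns identities between inner products into identities between Taylor coefficients.\<close>

lemma hardy_inner_monom_right:
  "hardy_inner \<zeta> g (\<lambda>z. z ^ m) = taylor_coeff g m * of_real ((\<zeta> m)\<^sup>2)"
  unfolding hardy_inner_def taylor_coeff_monom
  by (subst suminf_finite[of "{m}"]) auto

lemma hardy_inner_monom_left:
  "hardy_inner \<zeta> (\<lambda>z. z ^ m) g = cnj (taylor_coeff g m) * of_real ((\<zeta> m)\<^sup>2)"
  unfolding hardy_inner_def taylor_coeff_monom
  by (subst suminf_finite[of "{m}"]) auto

lemma taylor_coeff_scale:
  assumes "f holomorphic_on UNIV"
  shows "taylor_coeff (\<lambda>z. c * f (\<nu> * z)) = (\<lambda>n. c * \<nu> ^ n * taylor_coeff f n)"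
proof (rule taylor_coeff_eqI)
  fix z
  from sums_mult[OF taylor_coeff_sums[OF assms, of "\<nu> * z"], of c]
  show "(\<lambda>n. c * \<nu> ^ n * taylor_coeff f n * z ^ n) sums (c * f (\<nu> * z))"
    by (simp add: power_mult_distrib mult_ac)
qed

theorem theorem2p4:
  fixes \<zeta> :: "nat \<Rightarrow> real" and \<nu> :: complex and \<Upsilon> \<Phi> :: "complex \<Rightarrow> complex"
  assumes zeta_pos: "\<And>n. \<zeta> n > 0"
    and zeta_lim: "filterlim (\<lambda>n. root n (\<zeta> n)) at_top sequentially"
    and nu_le: "cmod \<nu> \<le> 1"
    and Phi_eq: "\<Phi> = (\<lambda>z. \<nu> * z)"
    and Upsilon_entire: "\<Upsilon> holomorphic_on UNIV"
    and bounded: "bounded_op_on \<zeta> (weighted_comp_op \<Upsilon> \<Phi>)"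
  shows "self_adjoint_on \<zeta> (weighted_comp_op \<Upsilon> \<Phi>) \<longleftrightarrow>
    (\<forall>z. \<Upsilon> z = cnj (\<Upsilon> 0)) \<and>
    (\<Upsilon> 0 = 0 \<longrightarrow>
       (\<forall>z. \<Upsilon> z = 0) \<and>
       (\<forall>f \<in> hardy_space_E \<zeta>. weighted_comp_op \<Upsilon> \<Phi> f = (\<lambda>z. 0))) \<and>
    (\<Upsilon> 0 \<noteq> 0 \<longrightarrow> \<nu> \<in> \<real>)"
proof
  let ?T = "weighted_comp_op \<Upsilon> \<Phi>"
  define c where "c = \<Upsilon> 0"
  assume sa: "self_adjoint_on \<zeta> ?T"
  have zeta_nz: "\<zeta> n \<noteq> 0" for n
    using zeta_pos[of n] by simp
  \<comment> \<open>Self-adjointness on the pair \<open>z ^ k\<close>, \<open>z ^ m\<close>: up to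
    the weights, the matrix of the operator in the monomials is Hermitian.\<close>
  have coeff: "taylor_coeff (?T (\<lambda>z. z ^ k)) m * of_real ((\<zeta> m)\<^sup>2) =
      cnj (taylor_coeff (?T (\<lambda>z. z ^ m)) k) * of_real ((\<zeta> k)\<^sup>2)" for k m
    unfolding hardy_inner_monom_left[symmetric] hardy_inner_monom_right[symmetric]
    using sa by (simp add: self_adjoint_on_def is_adjoint_on_def monom_in_hardy_space_E)
  have T_one: "?T (\<lambda>z. z ^ 0) = \<Upsilon>"
    by (simp add: weighted_comp_op_def)
  \<comment> \<open>For positive \<open>m\<close> the image of \<open>z ^ m\<close> vanishes at 0,
    so the right side of \<open>coeff\<close> with \<open>k = 0\<close> is zero.\<close>
  have higher: "taylor_coeff \<Upsilon> m = 0" if "m \<noteq> 0" for m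
    using coeff[of 0 m] zeta_nz[of m] that
    unfolding T_one taylor_coeff_0 by (simp add: power_0_left weighted_comp_op_def Phi_eq)
  have real_c: "cnj c = c"
    using coeff[of 0 0] zeta_nz[of 0] unfolding T_one taylor_coeff_0 c_def by simp
  have const: "\<Upsilon> z = c" for z
  proof -
    have "(\<Sum>n. taylor_coeff \<Upsilon> n * z ^ n) = (\<Sum>n\<in>{0}. taylor_coeff \<Upsilon> n * z ^ n)"
      by (rule suminf_finite) (auto simp: higher)
    with sums_unique[OF taylor_coeff_sums[OF Upsilon_entire, of z]] show ?thesis
      by (simp add: taylor_coeff_0 c_def)
  qed
  have "\<nu> \<in> \<real>" if nz: "c \<noteq> 0"
  proof -
    have "?T (\<lambda>z. z ^ 1) = (\<lambda>z. c * (\<lambda>w. w ^ 1) (\<nu> * z))"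
      by (simp add: weighted_comp_op_def Phi_eq const)
    then have "taylor_coeff (?T (\<lambda>z. z ^ 1)) 1 = c * \<nu>"
      using taylor_coeff_scale[of "\<lambda>w. w ^ 1" c \<nu>]
      by (simp add: taylor_coeff_monom[of 1, simplified])
    \<comment> \<open>A diagonal entry of a Hermitian matrix is real.\<close>
    with coeff[of 1 1] zeta_nz[of 1] have "c * \<nu> = cnj c * cnj \<nu>"
      by simp
    with nz real_c have "cnj \<nu> = \<nu>"
      by simp
    then show ?thesis
      by (simp add: Reals_cnj_iff)
  qed
  with const real_c show "(\<forall>z. \<Upsilon> z = cnj (\<Upsilon> 0)) \<and>
    (\<Upsilon> 0 = 0 \<longrightarrow> (\<forall>z. \<Upsilon> z = 0) \<and>
       (\<forall>f \<in> hardy_space_E \<zeta>. ?T f = (\<lambda>z. 0))) \<and>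
    (\<Upsilon> 0 \<noteq> 0 \<longrightarrow> \<nu> \<in> \<real>)"
    by (auto simp: weighted_comp_op_def)
next
  let ?T = "weighted_comp_op \<Upsilon> \<Phi>"
  define c where "c = \<Upsilon> 0"
  assume "(\<forall>z. \<Upsilon> z = cnj (\<Upsilon> 0)) \<and>
    (\<Upsilon> 0 = 0 \<longrightarrow> (\<forall>z. \<Upsilon> z = 0) \<and>
       (\<forall>f \<in> hardy_space_E \<zeta>. ?T f = (\<lambda>z. 0))) \<and>
    (\<Upsilon> 0 \<noteq> 0 \<longrightarrow> \<nu> \<in> \<real>)"
  then have const: "\<And>z. \<Upsilon> z = cnj c" and nu: "c \<noteq> 0 \<Longrightarrow> cnj \<nu> = \<nu>"
    unfolding c_def Reals_cnj_iff by blast+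
  have real_c: "cnj c = c"
    unfolding c_def by (rule const[of 0, unfolded c_def, symmetric])
  \<comment> \<open>If \<open>c = 0\<close>, then \<nu> may be non-real, but every eigenvalue is
    zero.\<close>
  have eig: "cnj (c * \<nu> ^ n) = c * \<nu> ^ n" for n
    using nu real_c by (cases "c = 0") auto
  have coeff: "taylor_coeff (?T f) n = c * \<nu> ^ n * taylor_coeff f n"
    if "f \<in> hardy_space_E \<zeta>" for f n
    using that taylor_coeff_scale[of f c \<nu>]
    by (simp add: hardy_space_E_iff weighted_comp_op_def Phi_eq const real_c)
  \<comment> \<open>The two series agree term by term: a real eigenvalue can be moved from one
    factor to the conjugated one.\<close>
  have "hardy_inner \<zeta> (?T f) g = hardy_inner \<zeta> f (?T g)"
    if "f \<in> hardy_space_E \<zeta>" "g \<in> hardy_space_E \<zeta>" for f g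
    unfolding hardy_inner_def coeff[OF that(1)] coeff[OF that(2)] complex_cnj_mult[of "c * _"] eig
    by (simp add: mult_ac)
  with bounded show "self_adjoint_on \<zeta> ?T"
    by (simp add: self_adjoint_on_def is_adjoint_on_def)
qed

end
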